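(* Let $D$ be an integral domain and let $\star$ be a semistar operation on $D$ with $\star=\star_f$ (i.e. $\star$ is of finite type). Let $I$ be a nonzero finitely generated $D$-submodule of the quotient field $K$ of $D$. Then the following are equivalent: (i) $I$ is $\star$-invertible; (ii) for each $Q\in\mathcal{M}(\star)$, $ID_Q$ is an invertible fractional ideal of $D_Q$ (and then $ID_Q$ is principal in $D_Q$); (iii) $I\,\mathrm{Na}(D,\star)$ is an invertible fractional ideal of $\mathrm{Na}(D,\star)$.
   Context: Let $D$ be an integral domain with quotient field $K$; $\overline{F}(D)$ is the set of nonzero $D$-submodules of $K$. A semistar operation on $D$ is a map $\star:\overline{F}(D)\to\overline{F}(D)$, $E\mapsto E^\star$, such that for all $0\ne x\in K$ and $E,F\in\overline{F}(D)$: $(xE)^\star=xE^\star$; $E\subseteq F$ implies $E^\star\subseteq F^\star$; $E\subseteq E^\star$ and $(E^\star)^\star=E^\star$. The semistar operation of finite type associated to $\star$ is $\star_f$, defined by $E^{\star_f}=\bigcup\{F^\star : F\subseteq E,\ F \text{ a nonzero finitely generated } D\text{-submodule of } K\}$; $\star$ is of finite type if $\star=\star_f$. For $E,F\in\overline{F}(D)$, $(E:F)=\{z\in K: zF\subseteq E\}$, and $I^{-1}=(D:I)$. A nonzero fractional ideal $I$ of $D$ is $\star$-invertible if $(II^{-1})^\star=D^\star$. A nonzero ideal $I\subseteq D$ is a quasi-$\star$-ideal if $I^\star\cap D=I$. $\mathcal{M}(\star)$ denotes the set of quasi-$\star$-maximal ideals, i.e. the maximal elements of the set of proper quasi-$\star$-ideals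 of $D$; when $\star$ is of finite type these are prime ideals. For $h\in D[X]$, $\boldsymbol{c}(h)$ is the content of $h$ (the ideal of $D$ generated by its coefficients). Put $N(\star)=\{h\in D[X]: h\neq 0,\ \boldsymbol{c}(h)^\star=D^\star\}$, a multiplicative subset of $D[X]$. The Nagata ring of $D$ with respect to $\star$ is $\mathrm{Na}(D,\star)=D[X]_{N(\star)}$. *)

theory Defs
  imports "HOL-Computational_Algebra.Computational_Algebra"
begin

text \<open>Every ring occurring here (the domain, its localizations, its Nagata ring) is an integral
  domain that lives inside its quotient field, so rings and their modules are represented as
  subsets of a field type: the domain and its localizations inside the quotient field
  \<open>'k\<close>, the Nagata ring inside the field \<open>'k poly fract\<close> of rational functions
  over \<open>'k\<close>.\<close>

definition is_subring :: "'k::field set \<Rightarrow> bool" where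
  "is_subring R \<longleftrightarrow> 0 \<in> R \<and> 1 \<in> R \<and>
     (\<forall>a\<in>R. \<forall>b\<in>R. a + b \<in> R \<and> a - b \<in> R \<and> a * b \<in> R)"

text \<open>The whole type \<open>'k\<close> is the quotient field of the domain \<open>D\<close>.\<close>

definition domain_with_quotient_field :: "'k::field set \<Rightarrow> bool" where
  "domain_with_quotient_field D \<longleftrightarrow> is_subring D \<and>
     (\<forall>x. \<exists>a\<in>D. \<exists>b\<in>D. b \<noteq> 0 \<and> x = a / b)"

definition submodule :: "'k::field set \<Rightarrow> 'k set \<Rightarrow> bool" where
  "submodule R E \<longleftrightarrow> 0 \<in> E \<and> (\<forall>x\<in>E. \<forall>y\<in>E. x + y \<in> E) \<and>
     (\<forall>r\<in>R. \<forall>x\<in>E. r * x \<in> E)"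

text \<open>Thus \<open>submodule R hull S\<close> is the \<open>R\<close>-submodule generated by \<open>S\<close>;
  for a \<open>D\<close>-submodule \<open>I\<close> and an overring \<open>R\<close> of \<open>D\<close> the extension
  \<open>I R\<close> is \<open>submodule R hull I\<close>.\<close>

definition fin_gen :: "'k::field set \<Rightarrow> 'k set \<Rightarrow> bool" where
  "fin_gen R E \<longleftrightarrow> (\<exists>S. finite S \<and> E = submodule R hull S)"

definition nonzero_submodules :: "'k::field set \<Rightarrow> 'k set set" where
  "nonzero_submodules R = {E. submodule R E \<and> E \<noteq> {0}}"

definition module_prod :: "'k::field set \<Rightarrow> 'k set \<Rightarrow> 'k set \<Rightarrow> 'k set" where
  "module_prod R E F = submodule R hull {x * y | x y. x \<in> E \<and> y \<in> F}"

definition colon :: "'k::field set \<Rightarrow> 'k set \<Rightarrow> 'k set" where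
  "colon E F = {z. \<forall>y\<in>F. z * y \<in> E}"

definition fractional_ideal :: "'k::field set \<Rightarrow> 'k set \<Rightarrow> bool" where
  "fractional_ideal R I \<longleftrightarrow> submodule R I \<and> (\<exists>d\<in>R. d \<noteq> 0 \<and> (\<forall>x\<in>I. d * x \<in> R))"

definition invertible_ideal :: "'k::field set \<Rightarrow> 'k set \<Rightarrow> bool" where
  "invertible_ideal R I \<longleftrightarrow> fractional_ideal R I \<and> module_prod R I (colon R I) = R"

definition principal_ideal :: "'k::field set \<Rightarrow> 'k set \<Rightarrow> bool" where
  "principal_ideal R I \<longleftrightarrow> (\<exists>x. I = (\<lambda>r. x * r) ` R)"

definition localization :: "'k::field set \<Rightarrow> 'k set \<Rightarrow> 'k set" where
  "localization R S = {a / s | a s. a \<in> R \<and> s \<in> S}"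

text \<open>A semistar operation is a map on the nonzero submodules; its values on other sets are
  irrelevant and left unconstrained.\<close>

definition semistar :: "'k::field set \<Rightarrow> ('k set \<Rightarrow> 'k set) \<Rightarrow> bool" where
  "semistar D star \<longleftrightarrow>
     (\<forall>E \<in> nonzero_submodules D. star E \<in> nonzero_submodules D) \<and>
     (\<forall>x. \<forall>E \<in> nonzero_submodules D. x \<noteq> 0 \<longrightarrow>
        star ((\<lambda>e. x * e) ` E) = (\<lambda>e. x * e) ` star E) \<and>
     (\<forall>E \<in> nonzero_submodules D. \<forall>F \<in> nonzero_submodules D.
        E \<subseteq> F \<longrightarrow> star E \<subseteq> star F) \<and>
     (\<forall>E \<in> nonzero_submodules D. E \<subseteq> star E \<and> star (star E) = star E)"

definition star_f :: "'k::field set \<Rightarrow> ('k set \<Rightarrow> 'k set) \<Rightarrow> 'k set \<Rightarrow> 'k set" where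
  "star_f D star E =
     \<Union>{star F | F. F \<subseteq> E \<and> F \<in> nonzero_submodules D \<and> fin_gen D F}"

definition finite_type :: "'k::field set \<Rightarrow> ('k set \<Rightarrow> 'k set) \<Rightarrow> bool" where
  "finite_type D star \<longleftrightarrow> (\<forall>E \<in> nonzero_submodules D. star E = star_f D star E)"

definition star_invertible :: "'k::field set \<Rightarrow> ('k set \<Rightarrow> 'k set) \<Rightarrow> 'k set \<Rightarrow> bool" where
  "star_invertible D star I \<longleftrightarrow> fractional_ideal D I \<and> I \<noteq> {0} \<and>
     star (module_prod D I (colon D I)) = star D"

definition quasi_star_ideal :: "'k::field set \<Rightarrow> ('k set \<Rightarrow> 'k set) \<Rightarrow> 'k set \<Rightarrow> bool" where
  "quasi_star_ideal D star I \<longleftrightarrow> I \<in> nonzero_submodules D \<and> I \<subseteq> D \<and> star I \<inter> D = I"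

definition quasi_star_maximal :: "'k::field set \<Rightarrow> ('k set \<Rightarrow> 'k set) \<Rightarrow> 'k set set" where
  "quasi_star_maximal D star =
     {Q. quasi_star_ideal D star Q \<and> Q \<noteq> D \<and>
         (\<forall>J. quasi_star_ideal D star J \<and> J \<noteq> D \<and> Q \<subseteq> J \<longrightarrow> J = Q)}"

text \<open>The polynomial ring over \<open>D\<close>, as a subset of the polynomials over its quotient field.\<close>

definition polys_over :: "'k::field set \<Rightarrow> 'k poly set" where
  "polys_over D = {h. \<forall>i. coeff h i \<in> D}"

definition content_ideal :: "'k::field set \<Rightarrow> 'k poly \<Rightarrow> 'k set" where
  "content_ideal D h = submodule D hull (range (coeff h))"

definition nagata_mult_set :: "'k::field set \<Rightarrow> ('k set \<Rightarrow> 'k set) \<Rightarrow> 'k poly set" where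
  "nagata_mult_set D star =
     {h \<in> polys_over D. h \<noteq> 0 \<and> star (content_ideal D h) = star D}"

definition nagata_ring ::
    "'k::field set \<Rightarrow> ('k set \<Rightarrow> 'k set) \<Rightarrow> 'k poly fract set" where
  "nagata_ring D star =
     localization (to_fract ` polys_over D) (to_fract ` nagata_mult_set D star)"

definition const_fract :: "'k::field \<Rightarrow> 'k poly fract" where
  "const_fract x = to_fract [:x:]"

end

theory Submission
  imports Defs
begin

text \<open>Put \<open>J = I I\<^sup>-\<^sup>1\<close>, a nonzero ideal of \<open>D\<close>. All three conditions say that \<open>J\<close> lies
  in no quasi-\<open>\<star>\<close>-maximal ideal.

  For \<open>\<star>\<close>-invertibility this is a general fact (\<open>star_eq_iff_not_subset_maximal\<close>): a nonzero ideal
  has the same closure as \<open>D\<close> exactly if it lies in no \<open>Q \<in> \<M>(\<star>)\<close>, because finite type makes unions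
  of chains of proper quasi-\<open>\<star>\<close>-ideals into proper quasi-\<open>\<star>\<close>-ideals, so that Zorn's lemma applies.
  The same fact turns the condition \<open>\<^bold>c(h)\<^sup>\<star> = D\<^sup>\<star>\<close> into: \<open>h \<notin> Q[X]\<close> for all
  \<open>Q \<in> \<M>(\<star>)\<close>. Since the \<open>Q\<close> are prime, so are the \<open>Q[X]\<close>, and therefore \<open>N(\<star>)\<close> is
  multiplicatively closed.

  Let \<open>R\<close> be \<open>D\<^sub>Q\<close> or the Nagata ring. Products of \<open>I\<close> and \<open>I\<^sup>-\<^sup>1\<close> are also products of
  \<open>I R\<close> and its inverse, so \<open>I R\<close> is invertible as soon as \<open>J\<close> generates the unit ideal of \<open>R\<close>
  (\<open>invertible_extensionI\<close>). In \<open>D\<^sub>Q\<close> this happens if \<open>J\<close> has an element outside \<open>Q\<close>. In the Nagata ring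
  it happens if \<open>J\<^sup>\<star> = D\<^sup>\<star>\<close>: by finite type some finitely generated \<open>F \<subseteq> J\<close> has \<open>F\<^sup>\<star> = D\<^sup>\<star>\<close>,
  and a polynomial whose coefficients are the generators of \<open>F\<close> is a unit of the Nagata ring.

  Conversely, suppose that \<open>I R\<close> is invertible and let \<open>M\<close> be the extension of \<open>Q\<close> to \<open>R\<close>, a proper ideal.
  Some product \<open>x w\<close> with \<open>x \<in> I\<close> and \<open>w\<close> in the inverse of \<open>I R\<close> is not in \<open>M\<close>
  (\<open>invertible_product_outside\<close>). As \<open>I\<close> is finitely generated, the denominators of \<open>w\<close> can be cleared
  on all of \<open>I\<close> at once (\<open>common_denominator\<close>), which moves \<open>w\<close> into \<open>I\<^sup>-\<^sup>1\<close>, or into the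
  polynomials over \<open>I\<^sup>-\<^sup>1\<close>; then \<open>J \<subseteq> Q\<close> would force \<open>x w \<in> M\<close>.\<close>

section \<open>Submodules of a field\<close>

lemma submodule_add: "submodule R E \<Longrightarrow> x \<in> E \<Longrightarrow> y \<in> E \<Longrightarrow> x + y \<in> E"
  and submodule_zero: "submodule R E \<Longrightarrow> 0 \<in> E"
  and submodule_scale: "submodule R E \<Longrightarrow> r \<in> R \<Longrightarrow> x \<in> E \<Longrightarrow> r * x \<in> E"
  by (auto simp: submodule_def)

lemma submoduleI:
  assumes "0 \<in> E" "\<And>x y. x \<in> E \<Longrightarrow> y \<in> E \<Longrightarrow> x + y \<in> E"
    "\<And>r x. r \<in> R \<Longrightarrow> x \<in> E \<Longrightarrow> r * x \<in> E"
  shows "submodule R E"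
  using assms by (auto simp: submodule_def)

lemma submodule_sum:
  assumes "submodule R E" "\<And>i. i \<in> A \<Longrightarrow> f i \<in> E"
  shows "sum f A \<in> E"
  using assms(2) by (induction A rule: infinite_finite_induct)
    (auto intro: submodule_add[OF assms(1)] submodule_zero[OF assms(1)])

lemma submodule_hull: "submodule R (submodule R hull S)"
  by (rule hull_in) (auto simp: submodule_def)

lemma submodule_preimage:
  assumes "submodule R E"
  shows "submodule R {x. w * x \<in> E}"
  using assms by (auto simp: submodule_def distrib_left mult.left_commute)

lemma subring_submodule: "is_subring R \<Longrightarrow> submodule R R"
  by (auto simp: is_subring_def submodule_def)

lemma ideal_eq_ring:
  assumes "submodule R E" "1 \<in> E"
  shows "R \<subseteq> E"
  using submodule_scale[OF assms(1) _ assms(2)] by auto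

lemma hull_scale_subset:
  assumes "submodule R E" "\<And>x. x \<in> S \<Longrightarrow> w * x \<in> E" "x \<in> submodule R hull S"
  shows "w * x \<in> E"
  using hull_minimal[of S "{x. w * x \<in> E}" "submodule R"] submodule_preimage[OF assms(1), of w]
    assms by auto

lemma module_prod_subset:
  assumes "submodule R M" "\<And>x y. x \<in> E \<Longrightarrow> y \<in> F \<Longrightarrow> x * y \<in> M"
  shows "module_prod R E F \<subseteq> M"
  unfolding module_prod_def using assms by (intro hull_minimal) auto

lemma submodule_module_prod: "submodule R (module_prod R E F)"
  unfolding module_prod_def by (rule submodule_hull)

lemma mult_in_module_prod: "x \<in> E \<Longrightarrow> y \<in> F \<Longrightarrow> x * y \<in> module_prod R E F"
  unfolding module_prod_def by (rule hull_inc) auto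

lemma colon_product_subset:
  assumes "is_subring R"
  shows "module_prod R E (colon R E) \<subseteq> R"
  by (rule module_prod_subset[OF subring_submodule[OF assms]])
     (auto simp: colon_def mult.commute)

section \<open>Localizations\<close>

definition mult_subset :: "'k::field set \<Rightarrow> 'k set \<Rightarrow> bool" where
  "mult_subset A S \<longleftrightarrow> S \<subseteq> A \<and> 1 \<in> S \<and> 0 \<notin> S \<and> (\<forall>s\<in>S. \<forall>t\<in>S. s * t \<in> S)"

lemma subset_localization:
  assumes "mult_subset A S"
  shows "M \<subseteq> localization M S"
proof
  fix x assume "x \<in> M"
  then have "x = x / 1" "x \<in> M" "1 \<in> S" using assms by (auto simp: mult_subset_def)
  then show "x \<in> localization M S" unfolding localization_def by blast
qed

lemma submodule_localization:
  assumes "submodule A M" "mult_subset A S"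
  shows "submodule (localization A S) (localization M S)"
proof (rule submoduleI)
  show "0 \<in> localization M S"
    using subset_localization[OF assms(2), of M] submodule_zero[OF assms(1)] by auto
next
  fix x y assume "x \<in> localization M S" "y \<in> localization M S"
  then obtain a s b t where *: "a \<in> M" "s \<in> S" "b \<in> M" "t \<in> S" "x = a / s" "y = b / t"
    unfolding localization_def by auto
  with assms(2) have st: "s \<noteq> 0" "t \<noteq> 0" "s \<in> A" "t \<in> A" "s * t \<in> S"
    by (auto simp: mult_subset_def)
  have "x + y = (t * a + s * b) / (s * t)"
    using * st by (simp add: field_simps)
  moreover have "t * a + s * b \<in> M"
    using * st assms(1) by (intro submodule_add[OF assms(1)] submodule_scale[OF assms(1)])
  ultimately show "x + y \<in> localization M S"
    using st unfolding localization_def by blast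
next
  fix r x assume "r \<in> localization A S" "x \<in> localization M S"
  then obtain a s b t where *: "a \<in> A" "s \<in> S" "b \<in> M" "t \<in> S" "r = a / s" "x = b / t"
    unfolding localization_def by auto
  have "r * x = (a * b) / (s * t)"
    using * by simp
  moreover have "s * t \<in> S" "a * b \<in> M"
    using * assms submodule_scale[OF assms(1)] by (auto simp: mult_subset_def)
  ultimately show "r * x \<in> localization M S"
    unfolding localization_def by blast
qed

lemma subring_localization:
  assumes "is_subring A" "mult_subset A S"
  shows "is_subring (localization A S)"
proof -
  let ?L = "localization A S"
  have L: "submodule ?L ?L"
    using submodule_localization[OF subring_submodule[OF assms(1)] assms(2)] .
  have A: "A \<subseteq> ?L" using subset_localization[OF assms(2)] .
  have "0 - 1 \<in> A" "1 \<in> A" using assms(1) unfolding is_subring_def by blast+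
  then have m1: "- 1 \<in> ?L" "1 \<in> ?L" using A by auto
  have "a - b \<in> ?L" if "a \<in> ?L" "b \<in> ?L" for a b
    using submodule_add[OF L that(1) submodule_scale[OF L m1(1) that(2)]] by simp
  then show ?thesis
    unfolding is_subring_def using L m1
    by (auto intro: submodule_zero submodule_add submodule_scale)
qed

lemma one_in_localization:
  assumes "1 \<in> localization M S" "mult_subset A S"
  shows "\<exists>s\<in>S. s \<in> M"
proof -
  obtain a s where "a \<in> M" "s \<in> S" "1 = a / s"
    using assms(1) unfolding localization_def by auto
  moreover have "s \<noteq> 0" using \<open>s \<in> S\<close> assms(2) by (auto simp: mult_subset_def)
  ultimately show ?thesis by auto
qed

text \<open>Finite generation of a module is exploited in this form: if multiplication by \<open>w\<close> maps each of finitely many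
  generators into the localization, then the product of the denominators moves all the values into
  \<open>A\<close>, and with them the image of the whole module.\<close>

lemma common_denominator:
  assumes "submodule A A" "mult_subset A S" "finite G"
    and "\<And>g. g \<in> G \<Longrightarrow> w * g \<in> localization A S"
  shows "\<exists>t\<in>S. \<forall>g\<in>G. t * w * g \<in> A"
  using assms(3,4)
proof (induction G)
  case empty
  then show ?case using assms(2) by (auto simp: mult_subset_def)
next
  case (insert g G)
  then obtain t where t: "t \<in> S" "\<forall>g\<in>G. t * w * g \<in> A" by auto
  have "w * g \<in> localization A S" using insert.prems by simp
  then obtain a s where s: "a \<in> A" "s \<in> S" "w * g = a / s"
    unfolding localization_def by auto
  have st: "s * t \<in> S" "s \<in> A" "t \<in> A" "s \<noteq> 0"
    using s t assms(2) by (auto simp: mult_subset_def)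
  have "s * t * w * g = t * a" using s st by (simp add: field_simps)
  then have "s * t * w * g \<in> A" using submodule_scale[OF assms(1) st(3) s(1)] by (simp only:)
  moreover have "s * t * w * g' \<in> A" if "g' \<in> G" for g'
    using submodule_scale[OF assms(1) st(2), of "t * w * g'"] t that by (simp add: mult.assoc)
  ultimately show ?case using st(1) by auto
qed

section \<open>Invertibility under extension of the ring\<close>

lemma invertible_idealI:
  assumes R: "is_subring R" and "submodule R E"
    and "d \<in> R" "d \<noteq> 0" "\<And>x. x \<in> E \<Longrightarrow> d * x \<in> R"
    and one: "1 \<in> module_prod R E (colon R E)"
  shows "invertible_ideal R E"
  using assms colon_product_subset[OF R, of E] ideal_eq_ring[OF submodule_module_prod one]
  unfolding invertible_ideal_def fractional_ideal_def by blast

text \<open>If all the products \<open>w x\<close> with \<open>x\<close> a generator were in \<open>M\<close>, then so would be the whole product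
  of the ideal with its inverse, in particular \<open>1\<close>.\<close>

lemma invertible_product_outside:
  assumes "invertible_ideal R (submodule R hull T)" "is_subring R"
    and M: "submodule R M" "1 \<notin> M"
  shows "\<exists>x\<in>T. \<exists>w\<in>colon R (submodule R hull T). w * x \<notin> M"
proof (rule ccontr)
  assume "\<not> ?thesis"
  then have "w * x \<in> M" if "x \<in> T" "w \<in> colon R (submodule R hull T)" for x w
    using that by blast
  then have "w * x \<in> M" if "x \<in> submodule R hull T" "w \<in> colon R (submodule R hull T)" for x w
    using hull_scale_subset[OF M(1)] that by blast
  then have "module_prod R (submodule R hull T) (colon R (submodule R hull T)) \<subseteq> M"
    by (intro module_prod_subset[OF M(1)]) (simp add: mult.commute)
  then have "R \<subseteq> M" using assms(1) by (simp add: invertible_ideal_def)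
  then show False using assms(2) M(2) by (auto simp: is_subring_def)
qed

definition field_embedding :: "('k::field \<Rightarrow> 'l::field) \<Rightarrow> bool" where
  "field_embedding \<phi> \<longleftrightarrow> \<phi> 1 = 1 \<and>
     (\<forall>x y. \<phi> (x + y) = \<phi> x + \<phi> y \<and> \<phi> (x * y) = \<phi> x * \<phi> y)"

lemma field_embedding_zero: "field_embedding \<phi> \<Longrightarrow> \<phi> 0 = 0"
  unfolding field_embedding_def by (metis add_cancel_right_right)

lemma field_embedding_nonzero:
  assumes "field_embedding \<phi>" "x \<noteq> 0"
  shows "\<phi> x \<noteq> 0"
proof -
  have "\<phi> x * \<phi> (inverse x) = 1"
    using assms unfolding field_embedding_def by (metis right_inverse)
  then show ?thesis by auto
qed

text \<open>An element of \<open>I\<^sup>-\<^sup>1\<close> maps into the inverse of the extension of \<open>I\<close>, so the extension of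
  \<open>I I\<^sup>-\<^sup>1\<close> is contained in the product of the extension of \<open>I\<close> with its inverse.\<close>

lemma invertible_extensionI:
  fixes \<phi> :: "'k::field \<Rightarrow> 'l::field"
  assumes \<phi>: "field_embedding \<phi>" and R: "is_subring R" and D: "\<phi> ` D \<subseteq> R"
    and I: "fractional_ideal D I"
    and one: "1 \<in> submodule R hull (\<phi> ` module_prod D I (colon D I))"
  shows "invertible_ideal R (submodule R hull (\<phi> ` I))"
proof -
  let ?E = "submodule R hull (\<phi> ` I)"
  let ?P = "module_prod R ?E (colon R ?E)"
  have hom: "\<phi> (x + y) = \<phi> x + \<phi> y" "\<phi> (x * y) = \<phi> x * \<phi> y" for x y
    using \<phi> by (auto simp: field_embedding_def)
  note RR = subring_submodule[OF R]
  have colon: "\<phi> y \<in> colon R ?E" if "y \<in> colon D I" for y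
  proof -
    have "\<phi> y * z \<in> R" if "z \<in> \<phi> ` I" for z
      using that \<open>y \<in> colon D I\<close> D by (auto simp: colon_def hom(2)[symmetric])
    then show ?thesis
      using hull_scale_subset[OF RR, of "\<phi> ` I" "\<phi> y"] by (auto simp: colon_def)
  qed
  have "module_prod D I (colon D I) \<subseteq> {z. \<phi> z \<in> ?P}"
  proof (rule module_prod_subset)
    have P: "submodule R ?P" by (rule submodule_module_prod)
    show "submodule D {z. \<phi> z \<in> ?P}"
      using D by (intro submoduleI)
        (auto simp: hom field_embedding_zero[OF \<phi>] intro: submodule_zero[OF P] submodule_add[OF P]
          submodule_scale[OF P])
  next
    fix x y assume "x \<in> I" "y \<in> colon D I"
    then show "x * y \<in> {z. \<phi> z \<in> ?P}"
      using colon[of y] by (auto simp: hom intro!: mult_in_module_prod hull_inc)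
  qed
  then have "submodule R hull (\<phi> ` module_prod D I (colon D I)) \<subseteq> ?P"
    by (intro hull_minimal submodule_module_prod) auto
  with one have one': "1 \<in> ?P" by auto
  obtain d where d: "d \<in> D" "d \<noteq> 0" "\<And>x. x \<in> I \<Longrightarrow> d * x \<in> D"
    using I unfolding fractional_ideal_def by auto
  have "\<phi> d * z \<in> R" if "z \<in> \<phi> ` I" for z
    using that d D by (auto simp: hom(2)[symmetric])
  then have "\<phi> d * z \<in> R" if "z \<in> ?E" for z
    using hull_scale_subset[OF RR] that by blast
  then show ?thesis
    using D d field_embedding_nonzero[OF \<phi> d(2)] one'
    by (intro invertible_idealI[OF R, of _ "\<phi> d"] submodule_hull) auto
qed

section \<open>Quasi-star-maximal ideals\<close>

locale semistar_domain =
  fixes D :: "'k::field set" and star :: "'k set \<Rightarrow> 'k set"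
  assumes domain: "domain_with_quotient_field D" and semistar: "semistar D star"
begin

lemma subring: "is_subring D"
  using domain by (simp add: domain_with_quotient_field_def)

lemma D_submodule: "submodule D D"
  by (rule subring_submodule[OF subring])

lemma one_in_D: "1 \<in> D" and zero_in_D: "0 \<in> D"
  using subring by (auto simp: is_subring_def)

lemma mult_in_D: "a \<in> D \<Longrightarrow> b \<in> D \<Longrightarrow> a * b \<in> D"
  using subring by (auto simp: is_subring_def)

lemma D_nonzero: "D \<in> nonzero_submodules D"
  using D_submodule one_in_D by (auto simp: nonzero_submodules_def)

lemma nonzero_submodulesI: "submodule D E \<Longrightarrow> x \<in> E \<Longrightarrow> x \<noteq> 0 \<Longrightarrow> E \<in> nonzero_submodules D"
  by (auto simp: nonzero_submodules_def)

lemma nonzero_submodulesE: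
  assumes "E \<in> nonzero_submodules D"
  obtains x where "submodule D E" "x \<in> E" "x \<noteq> 0"
  using assms submodule_zero[of D E] unfolding nonzero_submodules_def by auto

lemma star_nonzero: "E \<in> nonzero_submodules D \<Longrightarrow> star E \<in> nonzero_submodules D"
  and star_mono: "E \<in> nonzero_submodules D \<Longrightarrow> F \<in> nonzero_submodules D \<Longrightarrow> E \<subseteq> F \<Longrightarrow>
        star E \<subseteq> star F"
  and star_extensive: "E \<in> nonzero_submodules D \<Longrightarrow> E \<subseteq> star E"
  and star_idem: "E \<in> nonzero_submodules D \<Longrightarrow> star (star E) = star E"
  and star_scale: "E \<in> nonzero_submodules D \<Longrightarrow> x \<noteq> 0 \<Longrightarrow> star ((\<lambda>e. x * e) ` E) = (\<lambda>e. x * e) ` star E"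
  using semistar by (simp_all add: semistar_def)

lemma star_eq_iff_one:
  assumes "E \<in> nonzero_submodules D" "E \<subseteq> D"
  shows "star E = star D \<longleftrightarrow> 1 \<in> star E"
proof
  assume "star E = star D"
  then show "1 \<in> star E" using star_extensive[OF D_nonzero] one_in_D by auto
next
  assume "1 \<in> star E"
  then have "D \<subseteq> star E"
    using star_nonzero[OF assms(1)] by (intro ideal_eq_ring) (auto simp: nonzero_submodules_def)
  then have "star D \<subseteq> star E"
    using star_mono[OF D_nonzero star_nonzero[OF assms(1)]] star_idem[OF assms(1)] by simp
  then show "star E = star D" using star_mono[OF assms(1) D_nonzero assms(2)] by auto
qed

lemma quasi_star_ideal_closure:
  assumes "E \<in> nonzero_submodules D" "E \<subseteq> D"
  shows "quasi_star_ideal D star (star E \<inter> D)"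
proof -
  obtain x where x: "x \<in> E" "x \<noteq> 0" using assms(1) by (rule nonzero_submodulesE)
  have ne: "star E \<inter> D \<in> nonzero_submodules D"
  proof (rule nonzero_submodulesI)
    show "submodule D (star E \<inter> D)"
      using star_nonzero[OF assms(1)] D_submodule by (auto simp: submodule_def nonzero_submodules_def)
    show "x \<in> star E \<inter> D" using x star_extensive[OF assms(1)] assms(2) by auto
  qed (rule x)
  have "star (star E \<inter> D) \<subseteq> star E"
    using star_mono[OF ne star_nonzero[OF assms(1)]] star_idem[OF assms(1)] by auto
  then show ?thesis
    using ne star_extensive[OF ne] by (auto simp: quasi_star_ideal_def)
qed

lemma maximalD:
  assumes "Q \<in> quasi_star_maximal D star"
  shows "Q \<in> nonzero_submodules D" "submodule D Q" "Q \<subseteq> D" "star Q \<inter> D = Q" "1 \<notin> Q"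
proof -
  show *: "Q \<in> nonzero_submodules D" "submodule D Q" "Q \<subseteq> D" "star Q \<inter> D = Q"
    using assms by (auto simp: quasi_star_maximal_def quasi_star_ideal_def nonzero_submodules_def)
  have "Q \<noteq> D" using assms by (simp add: quasi_star_maximal_def)
  then show "1 \<notin> Q" using ideal_eq_ring[OF *(2)] *(3) by blast
qed

text \<open>If \<open>a \<notin> Q\<close> then maximality puts \<open>1\<close> into the closure of \<open>Q + a D\<close>, and multiplication by \<open>b\<close>
  moves this to \<open>b \<in> (b Q + a b D)\<^sup>\<star>\<close>. If also \<open>a b \<in> Q\<close>, the latter is contained in \<open>Q\<^sup>\<star>\<close>.\<close>

lemma maximal_prime:
  assumes Q: "Q \<in> quasi_star_maximal D star" and "a \<in> D" "b \<in> D" "a * b \<in> Q"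
  shows "a \<in> Q \<or> b \<in> Q"
proof (rule ccontr)
  assume "\<not> ?thesis"
  then have na: "a \<notin> Q" and nb: "b \<notin> Q" by auto
  note Qs = maximalD[OF Q]
  have b0: "b \<noteq> 0" using nb submodule_zero[OF Qs(2)] by auto
  let ?E = "submodule D hull (insert a Q)"
  have sub: "insert a Q \<subseteq> ?E" by (rule hull_subset)
  have ED: "?E \<subseteq> D" using assms Qs by (intro hull_minimal D_submodule) auto
  obtain x where x: "x \<in> Q" "x \<noteq> 0" using Qs(1) by (rule nonzero_submodulesE)
  have E: "?E \<in> nonzero_submodules D"
    using x sub by (intro nonzero_submodulesI[of _ x] submodule_hull) auto
  have "Q \<subseteq> star ?E \<inter> D" "a \<in> star ?E \<inter> D"
    using star_extensive[OF E] sub assms Qs by auto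
  then have "star ?E \<inter> D = D"
    using Q quasi_star_ideal_closure[OF E ED] na unfolding quasi_star_maximal_def by blast
  then have "b * 1 \<in> (\<lambda>e. b * e) ` star ?E" using one_in_D by blast
  then have b: "b \<in> star ((\<lambda>e. b * e) ` ?E)" using star_scale[OF E b0] by simp
  have "b * z \<in> Q" if "z \<in> insert a Q" for z
    using that assms(4) submodule_scale[OF Qs(2) assms(3)] by (metis insertE mult.commute)
  then have "b * z \<in> Q" if "z \<in> ?E" for z
    using hull_scale_subset[OF Qs(2)] that by blast
  then have bE: "(\<lambda>e. b * e) ` ?E \<subseteq> Q" by auto
  have "(\<lambda>e. b * e) ` ?E \<in> nonzero_submodules D"
  proof (rule nonzero_submodulesI)
    show "submodule D ((\<lambda>e. b * e) ` ?E)"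
    proof (rule submoduleI)
      show "0 \<in> (\<lambda>e. b * e) ` ?E"
        using submodule_zero[OF submodule_hull[of D "insert a Q"]] by (auto intro: image_eqI[of _ _ 0])
    next
      fix u v assume "u \<in> (\<lambda>e. b * e) ` ?E" "v \<in> (\<lambda>e. b * e) ` ?E"
      then show "u + v \<in> (\<lambda>e. b * e) ` ?E"
        by (auto simp: distrib_left[symmetric] intro!: imageI submodule_add[OF submodule_hull])
    next
      fix r u assume "r \<in> D" "u \<in> (\<lambda>e. b * e) ` ?E"
      then show "r * u \<in> (\<lambda>e. b * e) ` ?E"
        by (auto simp: mult.left_commute[of r b] intro!: imageI submodule_scale[OF submodule_hull])
    qed
    show "b * x \<in> (\<lambda>e. b * e) ` ?E" using x sub by auto
    show "b * x \<noteq> 0" using x b0 by simp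
  qed
  then have "b \<in> star Q" using b star_mono[OF _ Qs(1) bE] by auto
  then show False using Qs(4) \<open>b \<in> D\<close> nb by auto
qed

lemma mult_subset_compl:
  assumes "Q \<in> quasi_star_maximal D star"
  shows "mult_subset D (D - Q)"
  using maximalD[OF assms] maximal_prime[OF assms] one_in_D mult_in_D submodule_zero
  unfolding mult_subset_def by blast

lemma one_notin_extension:
  assumes "Q \<in> quasi_star_maximal D star"
  shows "1 \<notin> localization Q (D - Q)"
  using one_in_localization[OF _ mult_subset_compl[OF assms], of Q] by auto

end

locale finite_type_domain = semistar_domain +
  assumes finite_type: "finite_type D star"
begin

lemma star_finite_witness:
  assumes "E \<in> nonzero_submodules D" "x \<in> star E"
  obtains S where "finite S" "S \<subseteq> E" "submodule D hull S \<in> nonzero_submodules D"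
    "x \<in> star (submodule D hull S)"
proof -
  have "x \<in> star_f D star E" using assms finite_type by (auto simp: finite_type_def)
  then obtain F where F: "F \<subseteq> E" "F \<in> nonzero_submodules D" "fin_gen D F" "x \<in> star F"
    unfolding star_f_def by auto
  then obtain S where S: "finite S" "F = submodule D hull S" by (auto simp: fin_gen_def)
  moreover have "S \<subseteq> F" unfolding S(2) by (rule hull_subset)
  ultimately show ?thesis using that F by auto
qed

text \<open>An element of the closure of the union of a chain is in the closure of a submodule with finitely
  many generators, and these lie in one member of the chain.\<close>

lemma quasi_star_chain_Union:
  assumes chain: "subset.chain {J. quasi_star_ideal D star J \<and> J \<noteq> D} C" and "C \<noteq> {}"
  shows "quasi_star_ideal D star (\<Union>C) \<and> \<Union>C \<noteq> D"
proof -
  have C: "J \<in> nonzero_submodules D" "submodule D J" "J \<subseteq> D" "star J \<inter> D = J" "J \<noteq> D"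
    if "J \<in> C" for J
    using chain that by (auto simp: subset_chain_def quasi_star_ideal_def nonzero_submodules_def)
  have tot: "J \<subseteq> L \<or> L \<subseteq> J" if "J \<in> C" "L \<in> C" for J L
    using chain that by (auto simp: subset_chain_def)
  obtain J0 where J0: "J0 \<in> C" using \<open>C \<noteq> {}\<close> by auto
  have sub: "submodule D (\<Union>C)"
  proof (rule submoduleI)
    show "0 \<in> \<Union>C" using J0 C(2) submodule_zero by blast
  next
    fix x y assume "x \<in> \<Union>C" "y \<in> \<Union>C"
    then obtain J L where JL: "J \<in> C" "x \<in> J" "L \<in> C" "y \<in> L" by auto
    then show "x + y \<in> \<Union>C"
      using tot[OF JL(1,3)] submodule_add[OF C(2)] by blast
  next
    fix r x assume "r \<in> D" "x \<in> \<Union>C"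
    then show "r * x \<in> \<Union>C" using submodule_scale[OF C(2)] by blast
  qed
  obtain x0 where x0: "x0 \<in> J0" "x0 \<noteq> 0" using C(1)[OF J0] by (rule nonzero_submodulesE)
  have ne: "\<Union>C \<in> nonzero_submodules D"
    using sub x0 J0 by (intro nonzero_submodulesI[of _ x0]) auto
  have "x \<in> \<Union>C" if x: "x \<in> star (\<Union>C)" "x \<in> D" for x
  proof -
    obtain S where S: "finite S" "S \<subseteq> \<Union>C" "submodule D hull S \<in> nonzero_submodules D"
      "x \<in> star (submodule D hull S)"
      using star_finite_witness[OF ne x(1)] .
    obtain J where J: "J \<in> C" "S \<subseteq> J"
      using finite_subset_Union_chain[OF S(1,2) \<open>C \<noteq> {}\<close> chain] by auto
    have "submodule D hull S \<subseteq> J" using J C(2) by (intro hull_minimal) auto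
    then have "x \<in> star J" using star_mono[OF S(3) C(1)] J S(4) by auto
    then show ?thesis using C(4)[OF J(1)] J(1) x(2) by auto
  qed
  then have "quasi_star_ideal D star (\<Union>C)"
    using ne C(3) star_extensive[OF ne] unfolding quasi_star_ideal_def by blast
  moreover have "1 \<notin> \<Union>C"
    using C(5) ideal_eq_ring[OF C(2)] C(3) by blast
  ultimately show ?thesis using one_in_D by auto
qed

lemma quasi_star_ideal_subset_maximal:
  assumes "quasi_star_ideal D star J" "J \<noteq> D"
  obtains Q where "Q \<in> quasi_star_maximal D star" "J \<subseteq> Q"
proof -
  let ?A = "{L. quasi_star_ideal D star L \<and> L \<noteq> D \<and> J \<subseteq> L}"
  have "\<exists>Q\<in>?A. \<forall>X\<in>?A. Q \<subseteq> X \<longrightarrow> X = Q"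
  proof (rule subset_Zorn_nonempty)
    show "?A \<noteq> {}" using assms by auto
  next
    fix C assume C: "C \<noteq> {}" "subset.chain ?A C"
    then have "subset.chain {L. quasi_star_ideal D star L \<and> L \<noteq> D} C"
      by (auto simp: subset_chain_def)
    from quasi_star_chain_Union[OF this C(1)] show "\<Union>C \<in> ?A"
      using C unfolding subset_chain_def by blast
  qed
  then obtain Q where "Q \<in> ?A" "\<forall>X\<in>?A. Q \<subseteq> X \<longrightarrow> X = Q" by auto
  then show ?thesis using that[of Q] unfolding quasi_star_maximal_def by blast
qed

text \<open>If \<open>1 \<notin> E\<^sup>\<star>\<close>, then \<open>E\<^sup>\<star> \<inter> D\<close> is a proper quasi-star ideal containing \<open>E\<close>, hence
  lies in a maximal one.\<close>

lemma star_eq_iff_not_subset_maximal: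
  assumes "E \<in> nonzero_submodules D" "E \<subseteq> D"
  shows "star E = star D \<longleftrightarrow> (\<forall>Q\<in>quasi_star_maximal D star. \<not> E \<subseteq> Q)"
proof
  assume eq: "star E = star D"
  show "\<forall>Q\<in>quasi_star_maximal D star. \<not> E \<subseteq> Q"
  proof (intro ballI notI)
    fix Q assume Q: "Q \<in> quasi_star_maximal D star" "E \<subseteq> Q"
    have "1 \<in> star E" using eq star_eq_iff_one[OF assms] by simp
    then have "1 \<in> star Q" using star_mono[OF assms(1) maximalD(1)[OF Q(1)] Q(2)] by auto
    then show False using maximalD(4,5)[OF Q(1)] one_in_D by auto
  qed
next
  assume *: "\<forall>Q\<in>quasi_star_maximal D star. \<not> E \<subseteq> Q"
  have "star E \<inter> D = D"
  proof (rule ccontr)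
    assume "star E \<inter> D \<noteq> D"
    then obtain Q where "Q \<in> quasi_star_maximal D star" "star E \<inter> D \<subseteq> Q"
      using quasi_star_ideal_subset_maximal[OF quasi_star_ideal_closure[OF assms]] by blast
    then show False using * star_extensive[OF assms(1)] assms(2) by blast
  qed
  then show "star E = star D" using star_eq_iff_one[OF assms] one_in_D by auto
qed

section \<open>The Nagata ring\<close>

lemma content_subset_iff:
  assumes "submodule D M"
  shows "content_ideal D h \<subseteq> M \<longleftrightarrow> h \<in> polys_over M"
proof
  assume "content_ideal D h \<subseteq> M"
  then show "h \<in> polys_over M"
    using hull_subset[of "range (coeff h)" "submodule D"]
    by (auto simp: content_ideal_def polys_over_def)
next
  assume "h \<in> polys_over M"
  then show "content_ideal D h \<subseteq> M"
    unfolding content_ideal_def polys_over_def using assms by (intro hull_minimal) auto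
qed

lemma content_nonzero:
  assumes "h \<noteq> 0"
  shows "content_ideal D h \<in> nonzero_submodules D"
  unfolding content_ideal_def using assms
  by (intro nonzero_submodulesI[of _ "lead_coeff h"] submodule_hull hull_inc) auto

lemma nagata_mult_set_iff:
  "h \<in> nagata_mult_set D star \<longleftrightarrow>
     h \<in> polys_over D \<and> h \<noteq> 0 \<and> (\<forall>Q\<in>quasi_star_maximal D star. h \<notin> polys_over Q)"
proof (cases "h \<in> polys_over D \<and> h \<noteq> 0")
  case True
  then have "star (content_ideal D h) = star D \<longleftrightarrow>
      (\<forall>Q\<in>quasi_star_maximal D star. \<not> content_ideal D h \<subseteq> Q)"
    using content_subset_iff[OF D_submodule, of h] content_nonzero
    by (intro star_eq_iff_not_subset_maximal) auto
  with True show ?thesis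
    using content_subset_iff[OF maximalD(2)] by (auto simp: nagata_mult_set_def)
qed (auto simp: nagata_mult_set_def)

lemma polys_over_mult:
  assumes "submodule D M" "f \<in> polys_over D" "g \<in> polys_over M"
  shows "f * g \<in> polys_over M"
  using assms by (auto simp: polys_over_def coeff_mult intro!: submodule_sum submodule_scale)

lemma submodule_polys_over:
  assumes "submodule D M"
  shows "submodule (to_fract ` polys_over D) (to_fract ` polys_over M)"
proof (rule submoduleI)
  have "0 \<in> polys_over M" using submodule_zero[OF assms] by (simp add: polys_over_def)
  then show "0 \<in> to_fract ` polys_over M" by (metis image_eqI to_fract_0)
next
  fix x y assume "x \<in> to_fract ` polys_over M" "y \<in> to_fract ` polys_over M"
  then obtain f g where "f \<in> polys_over M" "g \<in> polys_over M" "x = to_fract f" "y = to_fract g"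
    by auto
  moreover from this have "f + g \<in> polys_over M"
    using submodule_add[OF assms] by (simp add: polys_over_def)
  ultimately show "x + y \<in> to_fract ` polys_over M" by (metis image_eqI to_fract_add)
next
  fix x y assume "x \<in> to_fract ` polys_over D" "y \<in> to_fract ` polys_over M"
  then show "x * y \<in> to_fract ` polys_over M"
    using polys_over_mult[OF assms] by (force simp flip: to_fract_mult)
qed

lemma subring_polys_over: "is_subring (to_fract ` polys_over D)"
proof -
  let ?A = "to_fract ` polys_over D"
  have A: "submodule ?A ?A" by (rule submodule_polys_over[OF D_submodule])
  have one: "1 \<in> ?A"
    using one_in_D zero_in_D by (intro image_eqI[of _ _ 1]) (auto simp: polys_over_def)
  have "a - b \<in> ?A" if ab: "a \<in> ?A" "b \<in> ?A" for a b
  proof -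
    obtain f g where fg: "f \<in> polys_over D" "g \<in> polys_over D" "a = to_fract f" "b = to_fract g"
      using ab by auto
    then have "f - g \<in> polys_over D" using subring by (simp add: polys_over_def is_subring_def)
    then show ?thesis using fg by (auto simp flip: to_fract_diff)
  qed
  then show ?thesis
    unfolding is_subring_def using one A
    by (auto intro: submodule_zero submodule_add submodule_scale)
qed

text \<open>Among the products of coefficients that add up to a coefficient of \<open>f g\<close>, take the one that is
  formed by the first coefficients of \<open>f\<close> and of \<open>g\<close> outside \<open>Q\<close>: all the others are in \<open>Q\<close>.\<close>

lemma polys_over_maximal_prime:
  assumes Q: "Q \<in> quasi_star_maximal D star"
    and D: "f \<in> polys_over D" "g \<in> polys_over D" and fg: "f * g \<in> polys_over Q"
  shows "f \<in> polys_over Q \<or> g \<in> polys_over Q"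
proof (rule ccontr)
  assume "\<not> ?thesis"
  then have ex: "\<exists>i. coeff f i \<notin> Q" "\<exists>j. coeff g j \<notin> Q" by (auto simp: polys_over_def)
  define i where "i = (LEAST i. coeff f i \<notin> Q)"
  define j where "j = (LEAST j. coeff g j \<notin> Q)"
  have i: "coeff f i \<notin> Q" "\<And>k. k < i \<Longrightarrow> coeff f k \<in> Q"
    using LeastI_ex[OF ex(1)] not_less_Least unfolding i_def by blast+
  have j: "coeff g j \<notin> Q" "\<And>k. k < j \<Longrightarrow> coeff g k \<in> Q"
    using LeastI_ex[OF ex(2)] not_less_Least unfolding j_def by blast+
  note sub = maximalD(2)[OF Q]
  have cD: "coeff f k \<in> D" "coeff g k \<in> D" for k using D by (auto simp: polys_over_def)
  let ?t = "\<lambda>k. coeff f k * coeff g (i + j - k)"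
  have rest: "(\<Sum>k\<in>{..i + j} - {i}. ?t k) \<in> Q"
  proof (rule submodule_sum[OF sub])
    fix k assume k: "k \<in> {..i + j} - {i}"
    show "?t k \<in> Q"
    proof (cases "k < i")
      case True
      then show ?thesis using submodule_scale[OF sub cD(2) i(2)] by (simp add: mult.commute)
    next
      case False
      then have "i + j - k < j" using k by auto
      then show ?thesis using submodule_scale[OF sub cD(1) j(2)] by simp
    qed
  qed
  have "coeff (f * g) (i + j) = ?t i + (\<Sum>k\<in>{..i + j} - {i}. ?t k)"
    unfolding coeff_mult by (subst sum.remove[of _ i]) auto
  moreover have "coeff (f * g) (i + j) \<in> Q" using fg by (simp add: polys_over_def)
  moreover have "- 1 \<in> D"
    using subring zero_in_D one_in_D unfolding is_subring_def by (metis diff_0)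
  ultimately have "coeff f i * coeff g j \<in> Q"
    using submodule_add[OF sub _ submodule_scale[OF sub \<open>- 1 \<in> D\<close> rest],
        of "coeff (f * g) (i + j)"] by simp
  then show False using maximal_prime[OF Q cD(1) cD(2)] i(1) j(1) by auto
qed

lemma mult_subset_nagata:
  "mult_subset (to_fract ` polys_over D) (to_fract ` nagata_mult_set D star)"
proof -
  have "1 \<in> nagata_mult_set D star"
    unfolding nagata_mult_set_iff using one_in_D zero_in_D maximalD(5)
    by (auto simp: polys_over_def intro: exI[of _ 0])
  moreover have "f * g \<in> nagata_mult_set D star"
    if "f \<in> nagata_mult_set D star" "g \<in> nagata_mult_set D star" for f g
    using that polys_over_mult[OF D_submodule, of f g] polys_over_maximal_prime[of _ f g]
    unfolding nagata_mult_set_iff by auto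
  ultimately show ?thesis
    unfolding mult_subset_def
    by (force simp: nagata_mult_set_def simp flip: to_fract_mult to_fract_1)
qed

lemma subring_nagata: "is_subring (nagata_ring D star)"
  unfolding nagata_ring_def
  by (rule subring_localization[OF subring_polys_over mult_subset_nagata])

lemma polys_subset_nagata: "to_fract ` polys_over D \<subseteq> nagata_ring D star"
  unfolding nagata_ring_def by (rule subset_localization[OF mult_subset_nagata])

lemma nagata_quotient:
  assumes "h \<in> nagata_mult_set D star" "f \<in> polys_over D"
  shows "to_fract f / to_fract h \<in> nagata_ring D star"
  using assms unfolding nagata_ring_def localization_def by blast

lemma const_fract_embedding: "field_embedding const_fract"
  by (auto simp: field_embedding_def const_fract_def simp flip: one_pCons to_fract_mult to_fract_add)

lemma const_fract_mult: "const_fract x * to_fract p = to_fract (smult x p)"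
  by (simp add: const_fract_def flip: to_fract_mult)

lemma const_fract_in_nagata: "const_fract ` D \<subseteq> nagata_ring D star"
proof
  fix z assume "z \<in> const_fract ` D"
  then obtain x where x: "x \<in> D" "z = const_fract x" by auto
  then have "[:x:] \<in> polys_over D" using zero_in_D
    by (auto simp: polys_over_def coeff_pCons split: nat.split)
  then show "z \<in> nagata_ring D star" using x polys_subset_nagata by (auto simp: const_fract_def)
qed

text \<open>By finite type, \<open>1 \<in> F\<^sup>\<star>\<close> for some finitely generated \<open>F \<subseteq> J\<close>. A polynomial
  \<open>h = \<Sum>i. a\<^sub>i X\<^sup>i\<close> whose coefficients generate \<open>F\<close> is in \<open>N(\<star>)\<close> and gives \<open>1 = (\<Sum>i. (X\<^sup>i / h) a\<^sub>i)\<close>, a linear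
  combination of the generators over the Nagata ring.\<close>

lemma one_in_nagata_extension:
  assumes J: "J \<in> nonzero_submodules D" "J \<subseteq> D" "star J = star D"
  shows "1 \<in> submodule (nagata_ring D star) hull (const_fract ` J)"
proof -
  let ?R = "nagata_ring D star"
  have "1 \<in> star J" using J star_eq_iff_one by auto
  then obtain S where S: "finite S" "S \<subseteq> J" "submodule D hull S \<in> nonzero_submodules D"
      "1 \<in> star (submodule D hull S)"
    using star_finite_witness[OF J(1)] by blast
  obtain xs where xs: "set xs = S" using finite_list[OF S(1)] by auto
  define h where "h = Poly xs"
  have J0: "0 \<in> J" "submodule D J" using J(1) submodule_zero by (auto simp: nonzero_submodules_def)
  have cJ: "coeff h i \<in> J" for i
    using S(2) xs J0 by (auto simp: h_def nth_default_def)
  have hD: "h \<in> polys_over D" using cJ J(2) by (auto simp: polys_over_def)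
  have "S \<subseteq> range (coeff h)"
  proof
    fix x assume "x \<in> S"
    then obtain i where "i < length xs" "x = xs ! i" using xs by (metis in_set_conv_nth)
    then have "x = coeff h i" by (simp add: h_def nth_default_def)
    then show "x \<in> range (coeff h)" by blast
  qed
  then have sub: "submodule D hull S \<subseteq> content_ideal D h"
    unfolding content_ideal_def by (rule hull_mono)
  obtain x where x: "x \<in> submodule D hull S" "x \<noteq> 0" using S(3) by (rule nonzero_submodulesE)
  have h0: "h \<noteq> 0"
  proof
    assume "h = 0"
    then have "content_ideal D h \<subseteq> {0}"
      unfolding content_ideal_def by (intro hull_minimal) (auto simp: submodule_def)
    then show False using x sub by auto
  qed
  have "1 \<in> star (content_ideal D h)"
    using star_mono[OF S(3) content_nonzero[OF h0] sub] S(4) by auto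
  then have h: "h \<in> nagata_mult_set D star"
    using star_eq_iff_one[OF content_nonzero[OF h0]] content_subset_iff[OF D_submodule] hD h0
    by (auto simp: nagata_mult_set_def)
  let ?H = "submodule ?R hull (const_fract ` J)"
  have term_in: "to_fract (monom 1 i) / to_fract h * const_fract (coeff h i) \<in> ?H" for i
  proof (rule submodule_scale[OF submodule_hull])
    show "to_fract (monom 1 i) / to_fract h \<in> ?R"
      using one_in_D zero_in_D by (intro nagata_quotient[OF h]) (auto simp: polys_over_def)
    show "const_fract (coeff h i) \<in> ?H" by (rule hull_inc) (use cJ in auto)
  qed
  have expansion: "to_fract h = (\<Sum>i\<le>degree h. const_fract (coeff h i) * to_fract (monom 1 i))"
  proof -
    have additive_sum: "to_fract (\<Sum>i\<le>n. f i) = (\<Sum>i\<le>n. to_fract (f i))"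
      for f :: "nat \<Rightarrow> 'a poly" and n
      by (induction n) simp_all
    have "to_fract h = to_fract (\<Sum>i\<le>degree h. monom (coeff h i) i)"
      by (simp add: poly_as_sum_of_monoms)
    also have "\<dots> = (\<Sum>i\<le>degree h. to_fract (monom (coeff h i) i))"
      using additive_sum .
    also have "\<dots> = (\<Sum>i\<le>degree h. const_fract (coeff h i) * to_fract (monom 1 i))"
      by (simp add: const_fract_mult smult_monom)
    finally show ?thesis .
  qed
  have "1 = to_fract h / to_fract h" using h0 by simp
  also have "\<dots> = (\<Sum>i\<le>degree h. to_fract (monom 1 i) / to_fract h * const_fract (coeff h i))"
    by (subst (1) expansion) (simp add: sum_divide_distrib mult.commute)
  also have "\<dots> \<in> ?H" by (rule submodule_sum[OF submodule_hull term_in])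
  finally show ?thesis .
qed

section \<open>Characterizations of star-invertibility\<close>

lemma fin_gen_fractional:
  assumes "fin_gen D I"
  shows "fractional_ideal D I"
proof -
  obtain G where G: "finite G" "I = submodule D hull G" using assms by (auto simp: fin_gen_def)
  have S: "mult_subset D (D - {0})"
    using one_in_D mult_in_D by (auto simp: mult_subset_def)
  have "x \<in> localization D (D - {0})" for x
    using domain unfolding domain_with_quotient_field_def localization_def by blast
  then obtain d where d: "d \<in> D - {0}" "\<forall>g\<in>G. d * 1 * g \<in> D"
    using common_denominator[OF D_submodule S G(1), of 1] by blast
  then have "d * x \<in> D" if "x \<in> I" for x
    using hull_scale_subset[OF D_submodule, of G d] that G(2) by auto
  then show ?thesis
    using d(1) submodule_hull unfolding fractional_ideal_def G(2) by auto
qed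

context
  fixes I :: "'a set"
  assumes I: "I \<in> nonzero_submodules D" "fin_gen D I"
begin

lemma trace_ideal:
  "module_prod D I (colon D I) \<in> nonzero_submodules D" "module_prod D I (colon D I) \<subseteq> D"
proof -
  obtain x where x: "x \<in> I" "x \<noteq> 0" using I(1) by (rule nonzero_submodulesE)
  obtain d where d: "d \<noteq> 0" "\<forall>x\<in>I. d * x \<in> D"
    using fin_gen_fractional[OF I(2)] unfolding fractional_ideal_def by auto
  show "module_prod D I (colon D I) \<in> nonzero_submodules D"
    using x d mult_in_module_prod[of x I d "colon D I" D]
    by (intro nonzero_submodulesI[of _ "x * d"] submodule_module_prod) (auto simp: colon_def)
  show "module_prod D I (colon D I) \<subseteq> D" by (rule colon_product_subset[OF subring])
qed

lemma star_invertible_iff: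
  "star_invertible D star I \<longleftrightarrow>
     (\<forall>Q\<in>quasi_star_maximal D star. \<not> module_prod D I (colon D I) \<subseteq> Q)"
  using star_eq_iff_not_subset_maximal[OF trace_ideal] fin_gen_fractional[OF I(2)] I(1)
  by (auto simp: star_invertible_def nonzero_submodules_def)

text \<open>If \<open>x y \<notin> Q\<close> with \<open>x \<in> I\<close> and \<open>y \<in> I\<^sup>-\<^sup>1\<close>, then every \<open>z \<in> I\<close> is a multiple
  \<open>z = x (y z) / (x y)\<close> of \<open>x\<close> over \<open>D\<^sub>Q\<close>.\<close>

lemma principal_localization:
  assumes Q: "Q \<in> quasi_star_maximal D star" and J: "\<not> module_prod D I (colon D I) \<subseteq> Q"
  shows "principal_ideal (localization D (D - Q)) (submodule (localization D (D - Q)) hull I)"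
proof -
  let ?R = "localization D (D - Q)"
  have R: "submodule ?R ?R"
    by (rule submodule_localization[OF D_submodule mult_subset_compl[OF Q]])
  obtain x y where xy: "x \<in> I" "y \<in> colon D I" "x * y \<notin> Q"
    using J module_prod_subset[OF maximalD(2)[OF Q]] by blast
  have xyD: "x * y \<in> D" using xy by (auto simp: colon_def mult.commute)
  have xy0: "x * y \<noteq> 0" using xy(3) submodule_zero[OF maximalD(2)[OF Q]] by auto
  have "submodule ?R hull I = (\<lambda>r. x * r) ` ?R"
  proof
    have "(1 / x) * z \<in> ?R" if "z \<in> I" for z
    proof -
      have "(1 / x) * z = (y * z) / (x * y)" using xy0 by (simp add: field_simps)
      moreover have "y * z \<in> D" using xy(2) that by (auto simp: colon_def)
      ultimately show ?thesis using xyD xy(3) unfolding localization_def by blast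
    qed
    then have "(1 / x) * z \<in> ?R" if "z \<in> submodule ?R hull I" for z
      using hull_scale_subset[OF R] that by blast
    moreover have "z = x * ((1 / x) * z)" for z using xy0 by simp
    ultimately show "submodule ?R hull I \<subseteq> (\<lambda>r. x * r) ` ?R" by blast
  next
    have "x \<in> submodule ?R hull I" using xy(1) by (rule hull_inc)
    then show "(\<lambda>r. x * r) ` ?R \<subseteq> submodule ?R hull I"
      using submodule_scale[OF submodule_hull, of _ ?R x I] by (auto simp: mult.commute)
  qed
  then show ?thesis by (auto simp: principal_ideal_def)
qed

text \<open>For the direct implication: if \<open>w\<close> is in the inverse of \<open>I D\<^sub>Q\<close>, then \<open>t w \<in> I\<^sup>-\<^sup>1\<close> for
  some \<open>t \<in> D - Q\<close>, so \<open>x w\<close> is in the extension of \<open>Q\<close> for all \<open>x \<in> I\<close> once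
  \<open>I I\<^sup>-\<^sup>1 \<subseteq> Q\<close>.\<close>

lemma invertible_localization_iff:
  assumes Q: "Q \<in> quasi_star_maximal D star"
  shows "invertible_ideal (localization D (D - Q)) (submodule (localization D (D - Q)) hull I) \<longleftrightarrow>
    \<not> module_prod D I (colon D I) \<subseteq> Q" (is "invertible_ideal ?R ?E \<longleftrightarrow> \<not> ?J \<subseteq> Q")
proof
  note S = mult_subset_compl[OF Q]
  assume inv: "invertible_ideal ?R ?E"
  show "\<not> ?J \<subseteq> Q"
  proof
    assume J: "?J \<subseteq> Q"
    obtain x w where xw: "x \<in> I" "w \<in> colon ?R ?E" "w * x \<notin> localization Q (D - Q)"
      using invertible_product_outside[OF inv subring_localization[OF subring S]
          submodule_localization[OF maximalD(2)[OF Q] S] one_notin_extension[OF Q]] by auto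
    obtain G where G: "finite G" "I = submodule D hull G" using I(2) by (auto simp: fin_gen_def)
    have "w * g \<in> ?R" if "g \<in> G" for g
    proof -
      have "g \<in> ?E" unfolding G(2) using that by (intro hull_inc)
      then show ?thesis using xw(2) by (simp add: colon_def)
    qed
    then obtain t where t: "t \<in> D - Q" "\<forall>g\<in>G. t * w * g \<in> D"
      using common_denominator[OF D_submodule S G(1)] by blast
    then have "t * w \<in> colon D I"
      using hull_scale_subset[OF D_submodule, of G "t * w"] by (auto simp: colon_def G(2))
    then have "x * (t * w) \<in> Q" using J mult_in_module_prod[OF xw(1)] by blast
    moreover have "w * x = (x * (t * w)) / t" using t(1) S by (auto simp: mult_subset_def)
    ultimately have "w * x \<in> localization Q (D - Q)" using t(1) unfolding localization_def by blast
    then show False using xw(3) by simp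
  qed
next
  note S = mult_subset_compl[OF Q]
  assume "\<not> ?J \<subseteq> Q"
  then obtain j where j: "j \<in> ?J" "j \<in> D - Q" using trace_ideal(2) by auto
  have "1 / j \<in> ?R" using j(2) one_in_D unfolding localization_def by blast
  then have "1 / j * j \<in> submodule ?R hull ?J"
    using j(1) by (intro submodule_scale[OF submodule_hull] hull_inc)
  moreover have "j \<noteq> 0" using j(2) submodule_zero[OF maximalD(2)[OF Q]] by auto
  ultimately have "1 \<in> submodule ?R hull ((\<lambda>x. x) ` ?J)" by simp
  then have "invertible_ideal ?R (submodule ?R hull ((\<lambda>x. x) ` I))"
    using subset_localization[OF S]
    by (intro invertible_extensionI[where D = D] subring_localization[OF subring S]
        fin_gen_fractional[OF I(2)]) (auto simp: field_embedding_def)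
  then show "invertible_ideal ?R ?E" by simp
qed

text \<open>The same argument with a denominator \<open>t \<in> N(\<star>)\<close> makes \<open>t w\<close> a polynomial with coefficients in
  \<open>I\<^sup>-\<^sup>1\<close>; if \<open>I I\<^sup>-\<^sup>1 \<subseteq> Q\<close>, then \<open>x t w \<in> Q[X]\<close> for all \<open>x \<in> I\<close>, whereas no member
  of \<open>N(\<star>)\<close> is in \<open>Q[X]\<close>.\<close>

lemma invertible_nagata_iff:
  "invertible_ideal (nagata_ring D star)
     (submodule (nagata_ring D star) hull (const_fract ` I)) \<longleftrightarrow>
   (\<forall>Q\<in>quasi_star_maximal D star. \<not> module_prod D I (colon D I) \<subseteq> Q)"
  (is "invertible_ideal ?R ?E \<longleftrightarrow> (\<forall>Q\<in>_. \<not> ?J \<subseteq> Q)")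
proof
  assume "\<forall>Q\<in>quasi_star_maximal D star. \<not> ?J \<subseteq> Q"
  then have "star ?J = star D" using star_eq_iff_not_subset_maximal[OF trace_ideal] by simp
  then have "1 \<in> submodule ?R hull (const_fract ` ?J)"
    by (rule one_in_nagata_extension[OF trace_ideal])
  then show "invertible_ideal ?R ?E"
    by (intro invertible_extensionI[OF const_fract_embedding subring_nagata const_fract_in_nagata
          fin_gen_fractional[OF I(2)]])
next
  assume inv: "invertible_ideal ?R ?E"
  show "\<forall>Q\<in>quasi_star_maximal D star. \<not> ?J \<subseteq> Q"
  proof (intro ballI notI)
    fix Q assume Q: "Q \<in> quasi_star_maximal D star" and J: "?J \<subseteq> Q"
    let ?A = "to_fract ` polys_over D" and ?N = "to_fract ` nagata_mult_set D star"
    let ?M = "localization (to_fract ` polys_over Q) ?N"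
    have M: "submodule ?R ?M"
      unfolding nagata_ring_def
      by (rule submodule_localization[OF submodule_polys_over[OF maximalD(2)[OF Q]]
            mult_subset_nagata])
    have "1 \<notin> ?M"
    proof
      assume "1 \<in> ?M"
      then have "\<exists>s\<in>to_fract ` nagata_mult_set D star. s \<in> to_fract ` polys_over Q"
        by (rule one_in_localization[OF _ mult_subset_nagata])
      then obtain h where "h \<in> nagata_mult_set D star" "h \<in> polys_over Q"
        by auto
      then show False using Q by (simp add: nagata_mult_set_iff)
    qed
    then obtain x w where xw: "x \<in> I" "w \<in> colon ?R ?E" "w * const_fract x \<notin> ?M"
      using invertible_product_outside[OF inv subring_nagata M] by auto
    obtain G where G: "finite G" "I = submodule D hull G" using I(2) by (auto simp: fin_gen_def)
    have "w * g \<in> localization ?A ?N" if "g \<in> const_fract ` G" for g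
    proof -
      have "g \<in> ?E" unfolding G(2) using that by (auto intro!: hull_inc)
      then show ?thesis using xw(2) by (simp add: colon_def nagata_ring_def)
    qed
    then have "\<exists>t\<in>?N. \<forall>g\<in>const_fract ` G. t * w * g \<in> ?A"
      by (rule common_denominator[OF submodule_polys_over[OF D_submodule] mult_subset_nagata
          finite_imageI[OF G(1)]])
    then obtain t where t: "t \<in> ?N" "\<forall>g\<in>const_fract ` G. t * w * g \<in> ?A" ..
    have "\<exists>g\<in>G. g \<noteq> 0"
    proof (rule ccontr)
      assume "\<not> ?thesis"
      then have "I \<subseteq> {0}" unfolding G(2) by (intro hull_minimal) (auto simp: submodule_def)
      then show False using I(1) by (auto elim: nonzero_submodulesE)
    qed
    then obtain g where g: "g \<in> G" "g \<noteq> 0" by auto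
    obtain f where f: "t * w * const_fract g = to_fract f" using t(2) g(1) by blast
    \<comment> \<open>Although \<open>t w\<close> need not have coefficients in \<open>D\<close>, it is a polynomial over the quotient field,
      since a nonzero constant multiple of it is one.\<close>
    define p where "p = smult (1 / g) f"
    have "const_fract g * to_fract p = to_fract f" using g(2) by (simp add: const_fract_mult p_def)
    then have "const_fract g * (t * w) = const_fract g * to_fract p"
      using f by (simp add: mult.commute)
    then have p: "t * w = to_fract p"
      using field_embedding_nonzero[OF const_fract_embedding g(2)] by simp
    have "coeff p i \<in> colon D I" for i
    proof -
      have "coeff p i * g' \<in> D" if "g' \<in> G" for g'
      proof -
        have "to_fract (smult g' p) \<in> ?A"
          using t(2) that p by (auto simp: mult.commute const_fract_mult)
        then have "smult g' p \<in> polys_over D" by auto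
        then show ?thesis by (simp add: polys_over_def mult.commute)
      qed
      then show ?thesis
        using hull_scale_subset[OF D_submodule, of G "coeff p i"] by (auto simp: colon_def G(2))
    qed
    then have "smult x p \<in> polys_over Q"
      using J mult_in_module_prod[OF xw(1)] by (auto simp: polys_over_def)
    moreover have "w * const_fract x = to_fract (smult x p) / t"
    proof -
      have "t \<noteq> 0" using t(1) mult_subset_nagata by (auto simp: mult_subset_def)
      then show ?thesis by (simp add: p[symmetric] mult.commute flip: const_fract_mult)
    qed
    ultimately have "w * const_fract x \<in> ?M" using t(1) unfolding localization_def by blast
    then show False using xw(3) by simp
  qed
qed

end

end

theorem theorem2p23:
  fixes D :: "'k::field set" and star :: "'k set \<Rightarrow> 'k set" and I :: "'k set"
  assumes "domain_with_quotient_field D"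
    and "semistar D star" and "finite_type D star"
    and "I \<in> nonzero_submodules D" and "fin_gen D I"
  shows "(star_invertible D star I \<longleftrightarrow>
           (\<forall>Q \<in> quasi_star_maximal D star.
              invertible_ideal (localization D (D - Q)) (submodule (localization D (D - Q)) hull I)))
       \<and> ((\<forall>Q \<in> quasi_star_maximal D star.
              invertible_ideal (localization D (D - Q)) (submodule (localization D (D - Q)) hull I))
          \<longleftrightarrow> invertible_ideal (nagata_ring D star)
                (submodule (nagata_ring D star) hull (const_fract ` I)))
       \<and> (\<forall>Q \<in> quasi_star_maximal D star.
            invertible_ideal (localization D (D - Q)) (submodule (localization D (D - Q)) hull I)
            \<longrightarrow> principal_ideal (localization D (D - Q)) (submodule (localization D (D - Q)) hull I))"
proof -
  interpret finite_type_domain D star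
    using assms(1-3) by unfold_locales
  show ?thesis
    using star_invertible_iff[OF assms(4,5)] invertible_nagata_iff[OF assms(4,5)]
      invertible_localization_iff[OF assms(4,5)] principal_localization[OF assms(4,5)]
    by auto
qed

end
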